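(* Let $0<p_1<p_2<1$. Let $F$ be any cdf, and let $F_1,F_2,\ldots$ be any sequence of (possibly random) cdf's that are unbiased estimators of $F$, that is, $\mathbb{E}( F_n(x) ) =F(x)$ for all $x\in \mathbb{R}$ and $n\in \mathbb{N}$, and such that $\mathbb{E}( F_n^{-1}(p) ) \in \mathbb{R}$ for all $n\in \mathbb{N}$ and $p\in \{p_1,p_2\}$. Then, for every $n\in\mathbb{N}$, $$\mathbb{E}\bigg(\int_{p_1}^{p_2} F_n^{-1}(u)\,du\bigg) -\int_{p_1}^{p_2} F^{-1}(u)\,du = \mathbb{E}\big(\mathrm{Rem}(p_2;F,F_n)\big) - \mathbb{E}\big(\mathrm{Rem}(p_1;F,F_n)\big) \in \mathbb{R} ,$$ where $$\mathrm{Rem}(p;F,F_n)=\int^{F^{-1}(p)}_{F_n^{-1}(p)} \big( F_n(x)-p\big)\, dx .$$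
   Context: The quantile function of a cdf $F$ is $F^{-1}(u)=\inf\{x\in\mathbb{R}: F(x)\ge u\}$ for $u\in(0,1]$ and $F^{-1}(0)=\lim_{u\downarrow 0}F^{-1}(u)$. The cdf $F$ is deterministic. The $F_n$ may be random: on an underlying probability space $(\Omega,\mathcal{A},\mathbb{P})$, $F_n:\Omega\times\mathbb{R}\to[0,1]$ is jointly measurable and $F_n(\omega,\cdot)$ is a cdf for almost all $\omega$. $\mathbb{E}(F_n^{-1}(p))\in\mathbb{R}$ means that this expectation exists and is finite. Integrals are oriented: $\int_a^b=-\int_b^a$ when $a>b$. *)

theory Defs
  imports "HOL-Probability.Probability"
begin

definition is_cdf :: "(real \<Rightarrow> real) \<Rightarrow> bool" where
  "is_cdf F \<longleftrightarrow> (\<exists>\<mu>. real_distribution \<mu> \<and> F = cdf \<mu>)"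

text \<open>
  The quantile function takes values in the extended reals, since it may be infinite at
  \<open>0\<close> and at \<open>1\<close>. For a cdf and \<open>0 < u < 1\<close> it is finite, so that
  applying \<^const>\<open>real_of_ereal\<close> there loses nothing. Only \<open>u \<in> {0..1}\<close> is
  meaningful.
\<close>
definition quantile :: "(real \<Rightarrow> real) \<Rightarrow> real \<Rightarrow> ereal" where
  "quantile F u =
     (if u = 0 then Lim (at_right 0) (\<lambda>v. INF x\<in>{x. v \<le> F x}. ereal x)
      else INF x\<in>{x. u \<le> F x}. ereal x)"

text \<open>
  On a null
  set of \<open>\<omega>\<close>, \<open>G \<omega>\<close> need not be a cdf, and functionals such as
  \<open>quantile (G \<omega>) p\<close> need not be measurable there. Expectations of such functionals,
  which are defined up to null sets only, are therefore taken with respect to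
  \<^term>\<open>completion M\<close>. On \<^term>\<open>M\<close>-measurable random variables this is the same as the
  expectation with respect to \<^term>\<open>M\<close>.
\<close>
definition random_cdf :: "'a measure \<Rightarrow> ('a \<Rightarrow> real \<Rightarrow> real) \<Rightarrow> bool" where
  "random_cdf M G \<longleftrightarrow>
     (\<lambda>(\<omega>, x). G \<omega> x) \<in> borel_measurable (M \<Otimes>\<^sub>M borel) \<and>
     (\<forall>\<omega>\<in>space M. \<forall>x. G \<omega> x \<in> {0..1}) \<and>
     (AE \<omega> in M. is_cdf (G \<omega>))"

text \<open>
  The interval integral of the library is oriented, as required here: the lower limit
  may exceed the upper one.
\<close>
definition Rem :: "real \<Rightarrow> (real \<Rightarrow> real) \<Rightarrow> (real \<Rightarrow> real) \<Rightarrow> real" where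
  "Rem p F G = (LBINT x=quantile G p..quantile F p. G x - p)"

end

theory Submission
  imports Defs
begin

text \<open>
  Write \<open>q\<^sub>i\<close> and \<open>Q\<^sub>i\<close> for the \<open>p\<^sub>i\<close>-quantiles of \<open>F\<close> and of a realisation \<open>G\<close> of \<open>F\<^sub>n\<close>.
  Integration by parts turns the integral of the quantile function of \<open>G\<close> over \<open>[p\<^sub>1, p\<^sub>2]\<close> into
  \<open>p\<^sub>2 Q\<^sub>2 - p\<^sub>1 Q\<^sub>1 - \<integral>_{Q\<^sub>1}^{Q\<^sub>2} G\<close>, and likewise for \<open>F\<close>. By additivity of oriented integrals, the
  difference of the two quantile integrals is then the difference of the two remainders minus
  \<open>\<integral>_{q\<^sub>1}^{q\<^sub>2} (G - F)\<close>. The endpoints of this last integral are deterministic, so its expectation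
  vanishes by Fubini and unbiasedness. Integrability holds because a remainder is bounded by the
  distance between the two quantiles.
\<close>

section \<open>Interval integrals\<close>

lemma interval_integrable_bounded:
  fixes f :: "real \<Rightarrow> real" and a b :: real
  assumes "f \<in> borel_measurable borel" and "\<And>x. \<bar>f x\<bar> \<le> B"
  shows "interval_lebesgue_integrable lborel a b f"
proof -
  have "set_integrable lborel {c<..<d} f" for c d
    unfolding set_integrable_def
    by (rule integrableI_bounded_set_indicator[where B = B])
      (use assms emeasure_bounded_finite[of "{c<..<d}"] in auto)
  then show ?thesis
    by (simp add: interval_lebesgue_integrable_def)
qed

lemma interval_integral_sum_bounded:
  fixes f :: "real \<Rightarrow> real" and a b c :: real
  assumes "f \<in> borel_measurable borel" and "\<And>x. \<bar>f x\<bar> \<le> B"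
  shows "(LBINT x=a..b. f x) + (LBINT x=b..c. f x) = (LBINT x=a..c. f x)"
proof (rule interval_integral_sum)
  show "interval_lebesgue_integrable lborel (min (ereal a) (min (ereal b) (ereal c)))
      (max (ereal a) (max (ereal b) (ereal c))) f"
    using interval_integrable_bounded[OF assms, of "min a (min b c)" "max a (max b c)"]
    by (simp add: min_def max_def split: if_splits)
qed

lemma interval_integral_abs_bound:
  fixes f :: "real \<Rightarrow> real" and a b :: real
  assumes f [measurable]: "f \<in> borel_measurable borel" and B: "\<And>x. \<bar>f x\<bar> \<le> B"
  shows "\<bar>LBINT x=a..b. f x\<bar> \<le> B * \<bar>b - a\<bar>"
proof -
  have *: "\<bar>LBINT x=c..d. f x\<bar> \<le> B * (d - c)" if "c \<le> d" for c d :: real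
  proof -
    have "\<bar>LBINT x=c..d. f x\<bar> \<le> (LINT x|lborel. indicator {c<..<d} x * B)"
      unfolding interval_lebesgue_integral_le_eq[OF ereal_less_eq(3)[THEN iffD2, OF that]]
        einterval_eq set_lebesgue_integral_def real_scaleR_def
    proof (rule integral_abs_bound_integral)
      show "integrable lborel (\<lambda>x. indicator {c<..<d} x * f x)"
        using interval_integrable_bounded[OF assms, of c d] that
        by (simp add: interval_lebesgue_integrable_def set_integrable_def)
      show "integrable lborel (\<lambda>x. indicator {c<..<d} x * B)"
        using that by (intro integrable_mult_left integrable_real_indicator) auto
      show "\<bar>indicator {c<..<d} x * f x\<bar> \<le> indicator {c<..<d} x * B" for x
        using B[of x] by (simp add: indicator_def)
    qed
    also have "\<dots> = B * (d - c)"
      using that by simp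
    finally show ?thesis .
  qed
  show ?thesis
  proof (cases "a \<le> b")
    case True
    then show ?thesis using * by simp
  next
    case False
    then show ?thesis
      using *[of b a] by (subst interval_integral_endpoints_reverse) simp
  qed
qed

lemma borel_measurable_interval_integral:
  fixes f :: "'a \<Rightarrow> real \<Rightarrow> real" and a b :: "'a \<Rightarrow> real"
  assumes f [measurable]: "(\<lambda>(\<omega>, x). f \<omega> x) \<in> borel_measurable (N \<Otimes>\<^sub>M borel)"
    and a [measurable]: "a \<in> borel_measurable N" and b [measurable]: "b \<in> borel_measurable N"
  shows "(\<lambda>\<omega>. LBINT x=a \<omega>..b \<omega>. f \<omega> x) \<in> borel_measurable N"
proof -
  \<comment> \<open>Moving the random endpoints into the integrand leaves integrals over all of
    \<open>lborel\<close> of jointly measurable functions, to which measurability of parametrised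
    integrals applies. The two branches are the two orientations.\<close>
  have eq: "(LBINT x=a \<omega>..b \<omega>. f \<omega> x) =
      (if a \<omega> \<le> b \<omega> then LINT x|lborel. (if a \<omega> < x \<and> x < b \<omega> then f \<omega> x else 0)
       else - (LINT x|lborel. (if b \<omega> < x \<and> x < a \<omega> then f \<omega> x else 0)))" for \<omega>
    by (auto simp: interval_lebesgue_integral_def set_lebesgue_integral_def indicator_def
        intro!: Bochner_Integration.integral_cong)
  show ?thesis
    unfolding eq by measurable
qed

text \<open>Completeness puts every subset of a null set into the sigma-algebra, so changing values
  on such a set keeps preimages measurable. This handles the \<open>\<omega>\<close> at which the
  realisation is not a cdf.\<close>

lemma borel_measurable_completion_AE:
  fixes f g :: "'a \<Rightarrow> real"
  assumes f: "f \<in> borel_measurable (completion M)" and eq: "AE x in M. f x = g x"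
  shows "g \<in> borel_measurable (completion M)"
proof (rule measurableI)
  fix A :: "real set" assume "A \<in> sets borel"
  with f have *: "f -` A \<inter> space M \<in> sets (completion M)"
    using measurable_sets[of f "completion M" borel A] by simp
  have "AE x in completion M. x \<in> f -` A \<inter> space M \<longleftrightarrow> x \<in> g -` A \<inter> space M"
    using AE_completion[OF eq] by eventually_elim simp
  from completion.in_sets_AE[OF this *]
  show "g -` A \<inter> space (completion M) \<in> sets (completion M)"
    by simp
qed simp

section \<open>Quantile functions\<close>

lemma is_cdfD:
  assumes "is_cdf F"
  shows is_cdf_mono: "mono F" and is_cdf_bounded: "\<And>x. 0 \<le> F x" "\<And>x. F x \<le> 1"
    and is_cdf_right_cont: "\<And>x. continuous (at_right x) F"
    and is_cdf_at_top: "(F \<longlongrightarrow> 1) at_top" and is_cdf_at_bot: "(F \<longlongrightarrow> 0) at_bot"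
proof -
  obtain \<mu> where "real_distribution \<mu>" and F: "F = cdf \<mu>"
    using assms by (auto simp: is_cdf_def)
  interpret real_distribution \<mu> by fact
  show "mono F" "\<And>x. 0 \<le> F x" "\<And>x. F x \<le> 1" "\<And>x. continuous (at_right x) F"
    "(F \<longlongrightarrow> 1) at_top" "(F \<longlongrightarrow> 0) at_bot"
    by (simp_all add: F mono_def cdf_nondecreasing cdf_nonneg cdf_bounded_prob cdf_is_right_cont
        cdf_lim_at_top_prob cdf_lim_at_bot)
qed

lemma is_cdf_measurable: "is_cdf F \<Longrightarrow> F \<in> borel_measurable borel"
  by (intro borel_measurable_mono is_cdf_mono)

text \<open>Right-continuity makes the infimum attained, so \<open>{x. u \<le> F x}\<close> is the
  closed half-line \<open>{q..}\<close>. All later facts about quantiles rest on this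
  equivalence.\<close>

lemma quantile_galois:
  assumes F: "is_cdf F" and u: "0 < u" "u < 1"
  obtains q where "quantile F u = ereal q" and "\<And>x. q \<le> x \<longleftrightarrow> u \<le> F x"
proof -
  define S where "S = {x. u \<le> F x}"
  define q where "q = Inf S"
  have "eventually (\<lambda>x. u < F x) at_top"
    using is_cdf_at_top[OF F] u by (auto simp: order_tendsto_iff)
  then obtain b where "u < F b"
    by (auto simp: eventually_at_top_linorder)
  then have ne: "S \<noteq> {}"
    by (auto simp: S_def intro!: exI[of _ b])
  have "eventually (\<lambda>x. F x < u) at_bot"
    using is_cdf_at_bot[OF F] u by (auto simp: order_tendsto_iff)
  then obtain a where a: "F a < u"
    by (auto simp: eventually_at_bot_linorder)
  have bdd: "bdd_below S"
  proof (rule bdd_belowI)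
    fix x assume "x \<in> S"
    then show "a \<le> x"
      using a monoD[OF is_cdf_mono[OF F], of x a] by (cases "a \<le> x") (auto simp: S_def)
  qed
  \<comment> \<open>Each point to the right of the infimum \<open>q\<close> exceeds some member of
    \<open>S\<close>, so monotonicity gives the bound there; the right limit then carries it over to
    \<open>q\<close> itself.\<close>
  have "eventually (\<lambda>x. u \<le> F x) (at_right q)"
    unfolding eventually_at_right_field
  proof (intro exI[of _ "q + 1"] conjI allI impI)
    fix x assume "q < x" "x < q + 1"
    then obtain y where "y \<in> S" "y < x"
      using cInf_lessD[OF ne, of x] by (auto simp: q_def)
    then show "u \<le> F x"
      using monoD[OF is_cdf_mono[OF F], of y x] by (auto simp: S_def)
  qed simp
  moreover have "(F \<longlongrightarrow> F q) (at_right q)"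
    using is_cdf_right_cont[OF F, of q] by (simp add: continuous_within)
  ultimately have "u \<le> F q"
    by (intro tendsto_lowerbound[of F "F q" "at_right q"]) auto
  then have iff: "q \<le> x \<longleftrightarrow> u \<le> F x" for x
    using monoD[OF is_cdf_mono[OF F], of q x] cInf_lower[OF _ bdd, of x]
    by (auto simp: S_def q_def)
  then have "{x. u \<le> F x} = {q..}"
    by auto
  then have "quantile F u = (INF x\<in>{q..}. ereal x)"
    using u by (simp add: quantile_def)
  also have "\<dots> = ereal q"
    by (rule antisym) (auto intro!: INF_lower2[of q] INF_greatest)
  finally show ?thesis
    using iff that by blast
qed

definition rquantile :: "(real \<Rightarrow> real) \<Rightarrow> real \<Rightarrow> real" where
  "rquantile F u = real_of_ereal (quantile F u)"

lemma
  assumes "is_cdf F" "0 < u" "u < 1"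
  shows quantile_eq_rquantile: "quantile F u = ereal (rquantile F u)"
    and rquantile_le_iff: "rquantile F u \<le> x \<longleftrightarrow> u \<le> F x"
  using quantile_galois[OF assms] by (metis rquantile_def real_of_ereal.simps(1))+

lemma rquantile_mono:
  assumes "is_cdf F" "0 < u" "u \<le> v" "v < 1"
  shows "rquantile F u \<le> rquantile F v"
  using assms rquantile_le_iff[of F u "rquantile F v"] rquantile_le_iff[of F v "rquantile F v"]
  by auto

text \<open>Integration by parts: both sides compute, by slicing in the two directions, the area of the
  region \<open>{(u, x). p1 < u < p2, q1 \<le> x < q2, u \<le> F x}\<close>, with \<open>q1\<close>, \<open>q2\<close> the two quantiles.\<close>
lemma integral_quantile:
  assumes F: "is_cdf F" and p: "0 < p1" "p1 < p2" "p2 < 1"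
  shows "(LBINT u=p1..p2. rquantile F u) =
    p2 * rquantile F p2 - p1 * rquantile F p1 - (LBINT x=rquantile F p1..rquantile F p2. F x)"
proof -
  define q1 q2 where q: "q1 = rquantile F p1" "q2 = rquantile F p2"
  \<comment> \<open>Excluding \<open>q2\<close> gives \<open>F x < p2\<close> on the strip, and
    including \<open>q1\<close> gives \<open>p1 \<le> F x\<close>. Hence the slice at
    \<open>x\<close> is exactly \<open>{p1<..F x}\<close>, without truncation at
    \<open>p2\<close>.\<close>
  define A where "A = {(u, x). p1 < u \<and> u < p2 \<and> q1 \<le> x \<and> x < q2 \<and> u \<le> F x}"
  note [measurable] = is_cdf_measurable[OF F]
  have q12: "q1 \<le> q2"
    unfolding q using p by (intro rquantile_mono[OF F]) auto
  have A_meas [measurable]: "A \<in> sets (lborel \<Otimes>\<^sub>M lborel)"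
  proof -
    have "A = {z \<in> space (lborel \<Otimes>\<^sub>M lborel). p1 < fst z \<and> fst z < p2 \<and> q1 \<le> snd z \<and>
        snd z < q2 \<and> fst z \<le> F (snd z)}"
      by (auto simp: A_def space_pair_measure)
    also have "\<dots> \<in> sets (lborel \<Otimes>\<^sub>M lborel)"
      by measurable
    finally show ?thesis .
  qed
  have "emeasure (lborel \<Otimes>\<^sub>M lborel) A \<le> emeasure (lborel \<Otimes>\<^sub>M lborel) ({p1..p2} \<times> {q1..q2})"
    by (rule emeasure_mono) (auto simp: A_def)
  also have "\<dots> < \<infinity>"
    using p q12 by (simp add: lborel.emeasure_pair_measure_Times ennreal_mult[symmetric])
  finally have int: "integrable (lborel \<Otimes>\<^sub>M lborel) (\<lambda>(u, x). indicator A (u, x) :: real)"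
    using integrable_real_indicator[OF A_meas] by (simp add: case_prod_beta')
  have slice1: "(LINT x|lborel. indicator A (u, x)) = indicator {p1<..<p2} u * (q2 - rquantile F u)"
    for u
  proof (cases "p1 < u \<and> u < p2")
    case True
    then have u: "q1 \<le> rquantile F u" "rquantile F u \<le> q2"
      unfolding q using p by (auto intro!: rquantile_mono[OF F])
    have "indicat_real A (u, x) = indicator {rquantile F u..<q2} x" for x
      using True u p rquantile_le_iff[OF F, of u x] by (auto simp: A_def indicator_def)
    then show ?thesis
      using True u by simp
  qed (auto simp: A_def indicator_def)
  have slice2: "(LINT u|lborel. indicator A (u, x)) = indicator {q1..<q2} x * (F x - p1)" for x
  proof (cases "q1 \<le> x \<and> x < q2")
    case True
    then have "p1 \<le> F x" "F x < p2"
      using p rquantile_le_iff[OF F, of p1 x] rquantile_le_iff[OF F, of p2 x] by (auto simp: q)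
    moreover from this True have "indicat_real A (u, x) = indicator {p1<..F x} u" for u
      by (auto simp: A_def indicator_def)
    ultimately show ?thesis
      using True by simp
  qed (auto simp: A_def indicator_def)
  \<comment> \<open>Fubini yields measurability and integrability of the quantile function between
    \<open>p1\<close> and \<open>p2\<close> as a by-product of the finite area of
    \<open>A\<close>.\<close>
  have "integrable lborel (\<lambda>u. indicator {p1<..<p2} u * (q2 - rquantile F u))"
    using lborel_pair.integrable_fst[OF int] by (simp add: slice1)
  then have int1: "interval_lebesgue_integrable lborel p1 p2 (\<lambda>u. q2 - rquantile F u)"
    using p by (simp add: interval_lebesgue_integrable_def set_integrable_def)
  have F_abs: "\<bar>F x\<bar> \<le> 1" for x
    using is_cdf_bounded[OF F, of x] by simp
  have "(LBINT u=p1..p2. q2 - rquantile F u) = (LINT u|lborel. LINT x|lborel. indicator A (u, x))"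
    using p by (simp add: slice1 interval_lebesgue_integral_def set_lebesgue_integral_def)
  also have "\<dots> = (LINT x|lborel. LINT u|lborel. indicator A (u, x))"
    by (rule lborel_pair.Fubini_integral[OF int, symmetric])
  also have "\<dots> = (LBINT x=q1..q2. F x - p1)"
    using q12 by (simp add: slice2 interval_integral_Ico set_lebesgue_integral_def)
  also have "\<dots> = (LBINT x=q1..q2. F x) - p1 * (q2 - q1)"
    using interval_integrable_bounded[OF is_cdf_measurable[OF F] F_abs, of q1 q2]
    by simp
  finally have eq: "(LBINT u=p1..p2. q2 - rquantile F u) =
    (LBINT x=q1..q2. F x) - p1 * (q2 - q1)" .
  have "(LBINT u=p1..p2. rquantile F u) = (LBINT u=p1..p2. q2 - (q2 - rquantile F u))"
    by simp
  also have "\<dots> = q2 * (p2 - p1) - (LBINT u=p1..p2. q2 - rquantile F u)"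
    by (subst interval_lebesgue_integral_diff[OF _ int1]) auto
  finally show ?thesis
    using eq by (simp add: q algebra_simps)
qed

lemma Rem_eq:
  assumes F: "is_cdf F" and G: "is_cdf G" and p: "0 < p" "p < 1"
  shows "Rem p F G = (LBINT x=rquantile G p..rquantile F p. G x - p)"
  by (simp add: Rem_def quantile_eq_rquantile[OF F p] quantile_eq_rquantile[OF G p])

text \<open>This is the pathwise identity behind the theorem. The constants
  \<open>p * (rquantile F p - rquantile G p)\<close> from the remainders cancel against the boundary
  terms of the two integrations by parts.\<close>

lemma Rem_diff:
  assumes F: "is_cdf F" and G: "is_cdf G" and p: "0 < p1" "p1 < p2" "p2 < 1"
  shows "Rem p2 F G - Rem p1 F G =
    (LBINT u=p1..p2. rquantile G u) - (LBINT u=p1..p2. rquantile F u)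
    + ((LBINT x=rquantile F p1..rquantile F p2. G x)
      - (LBINT x=rquantile F p1..rquantile F p2. F x))"
proof -
  have bnd: "\<bar>G x\<bar> \<le> 1" for x
    using is_cdf_bounded[OF G, of x] by simp
  note sum = interval_integral_sum_bounded[OF is_cdf_measurable[OF G] bnd]
  have split: "Rem p F G = (LBINT x=rquantile G p..rquantile F p. G x)
      - p * (rquantile F p - rquantile G p)" if "0 < p" "p < 1" for p
    using Rem_eq[OF F G that] interval_integrable_bounded[OF is_cdf_measurable[OF G] bnd] by simp
  \<comment> \<open>Both sides are the integral of \<open>G\<close> from
    \<open>rquantile G p1\<close> to \<open>rquantile F p2\<close>, split at different points.
    Orientation makes this valid for every ordering of the four quantiles.\<close>
  have "(LBINT x=rquantile G p1..rquantile G p2. G x) + (LBINT x=rquantile G p2..rquantile F p2. G x)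
    = (LBINT x=rquantile G p1..rquantile F p1. G x) + (LBINT x=rquantile F p1..rquantile F p2. G x)"
    by (simp only: sum)
  then show ?thesis
    using p by (simp add: split integral_quantile[OF F p] integral_quantile[OF G p] algebra_simps)
qed

section \<open>Random distribution functions\<close>

text \<open>The random endpoint \<open>rquantile (G \<omega>) p\<close> is known to be measurable
  only for the completion, so the integrand has to be lifted to the same sigma-algebra.\<close>

lemma random_cdf_measurable_completion:
  assumes "random_cdf M G"
  shows "(\<lambda>(\<omega>, x). G \<omega> x) \<in> borel_measurable (completion M \<Otimes>\<^sub>M borel)"
proof -
  have [measurable]: "(\<lambda>(\<omega>, x). G \<omega> x) \<in> borel_measurable (M \<Otimes>\<^sub>M borel)"
    using assms by (simp add: random_cdf_def)
  have [measurable]: "(\<lambda>\<omega>. \<omega>) \<in> completion M \<rightarrow>\<^sub>M M"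
    by (rule measurable_completion) simp
  have "(\<lambda>z. (fst z, snd z)) \<in> completion M \<Otimes>\<^sub>M borel \<rightarrow>\<^sub>M M \<Otimes>\<^sub>M borel"
    by (intro measurable_Pair measurable_snd measurable_compose[OF measurable_fst]) measurable
  from measurable_compose[OF this, of "\<lambda>(\<omega>, x). G \<omega> x" borel] show ?thesis
    by (simp add: case_prod_beta')
qed

text \<open>Since \<open>G \<omega> x\<close> and \<open>p\<close> lie in the unit interval, the
  integrand is at most 1 in modulus, so the distance between the two quantiles is an integrable
  majorant.\<close>

lemma integrable_Rem:
  assumes M: "prob_space M" and F: "is_cdf F" and G: "random_cdf M G" and p: "0 < p" "p < 1"
    and int: "integrable (completion M) (\<lambda>\<omega>. rquantile (G \<omega>) p)"
  shows "integrable (completion M) (\<lambda>\<omega>. Rem p F (G \<omega>))"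
proof -
  interpret M: prob_space M by fact
  interpret C: prob_space "completion M"
    by (rule prob_spaceI) (simp add: M.emeasure_space_1)
  have cdf: "AE \<omega> in M. is_cdf (G \<omega>)"
    using G by (simp add: random_cdf_def)
  have [measurable]: "(\<lambda>(\<omega>, x). G \<omega> x) \<in> borel_measurable (completion M \<Otimes>\<^sub>M borel)"
    by (rule random_cdf_measurable_completion[OF G])
  have "(\<lambda>\<omega>. LBINT x=rquantile (G \<omega>) p..rquantile F p. G \<omega> x - p)
      \<in> borel_measurable (completion M)"
    using int by (intro borel_measurable_interval_integral) auto
  moreover have "AE \<omega> in M. (LBINT x=rquantile (G \<omega>) p..rquantile F p. G \<omega> x - p) = Rem p F (G \<omega>)"
    using cdf by eventually_elim (simp add: Rem_eq[OF F _ p])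
  ultimately have meas: "(\<lambda>\<omega>. Rem p F (G \<omega>)) \<in> borel_measurable (completion M)"
    by (rule borel_measurable_completion_AE)
  have "AE \<omega> in completion M. norm (Rem p F (G \<omega>)) \<le> norm (\<bar>rquantile F p - rquantile (G \<omega>) p\<bar>)"
    using AE_completion[OF cdf]
  proof eventually_elim
    case (elim \<omega>)
    note [measurable] = is_cdf_measurable[OF elim]
    have "\<bar>G \<omega> x - p\<bar> \<le> 1" for x
      using is_cdf_bounded[OF elim, of x] p by auto
    then have "\<bar>Rem p F (G \<omega>)\<bar> \<le> 1 * \<bar>rquantile F p - rquantile (G \<omega>) p\<bar>"
      unfolding Rem_eq[OF F elim p] by (intro interval_integral_abs_bound) auto
    then show ?case by simp
  qed
  then show ?thesis
    by (rule Bochner_Integration.integrable_bound[rotated 2])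
      (intro integrable_abs Bochner_Integration.integrable_diff C.integrable_const int meas)+
qed

text \<open>With deterministic endpoints the integral is already measurable for \<open>M\<close>, so
  Fubini is applied there and only the result is moved to the completion.\<close>

lemma expectation_interval_integral:
  fixes a b :: real
  assumes M: "prob_space M" and G: "random_cdf M G" and ab: "a \<le> b"
  shows "integrable (completion M) (\<lambda>\<omega>. LBINT x=a..b. G \<omega> x)"
    and "(\<integral>\<omega>. (LBINT x=a..b. G \<omega> x) \<partial>completion M) = (LBINT x=a..b. (\<integral>\<omega>. G \<omega> x \<partial>M))"
proof -
  interpret M: prob_space M by fact
  interpret P: pair_sigma_finite M "lborel :: real measure" ..
  have [measurable]: "(\<lambda>(\<omega>, x). G \<omega> x) \<in> borel_measurable (M \<Otimes>\<^sub>M borel)"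
    using G by (simp add: random_cdf_def)
  have bnd: "\<bar>G \<omega> x\<bar> \<le> 1" if "\<omega> \<in> space M" for \<omega> x
    using G that by (auto simp: random_cdf_def)
  \<comment> \<open>The integrand is bounded by 1 and supported on a strip of measure
    \<open>b - a\<close>.\<close>
  have int: "integrable (M \<Otimes>\<^sub>M lborel) (\<lambda>(\<omega>, x). indicator {a<..<b} x * G \<omega> x)"
  proof (rule integrableI_bounded_set[where A = "space M \<times> {a<..<b}" and B = 1])
    show "(\<lambda>(\<omega>, x). indicator {a<..<b} x * G \<omega> x) \<in> borel_measurable (M \<Otimes>\<^sub>M lborel)"
      by measurable
    show "emeasure (M \<Otimes>\<^sub>M lborel) (space M \<times> {a<..<b}) < \<infinity>"
      using ab by (simp add: lborel.emeasure_pair_measure_Times M.emeasure_space_1)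
  qed (use bnd in \<open>auto simp: indicator_def space_pair_measure\<close>)
  have eq: "(LBINT x=a..b. g x) = (LINT x|lborel. indicator {a<..<b} x * g x)" for g :: "real \<Rightarrow> real"
    using ab by (simp add: interval_lebesgue_integral_def set_lebesgue_integral_def)
  have intM: "integrable M (\<lambda>\<omega>. LBINT x=a..b. G \<omega> x)"
    unfolding eq using P.integrable_fst[OF int] by simp
  then show "integrable (completion M) (\<lambda>\<omega>. LBINT x=a..b. G \<omega> x)"
    by (subst integrable_completion) auto
  have "(\<integral>\<omega>. (LBINT x=a..b. G \<omega> x) \<partial>completion M) = (\<integral>\<omega>. (LBINT x=a..b. G \<omega> x) \<partial>M)"
    using intM by (intro integral_completion) auto
  also have "\<dots> = (LINT x|lborel. \<integral>\<omega>. indicator {a<..<b} x * G \<omega> x \<partial>M)"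
    unfolding eq by (rule P.Fubini_integral[OF int, symmetric])
  finally show "(\<integral>\<omega>. (LBINT x=a..b. G \<omega> x) \<partial>completion M) = (LBINT x=a..b. (\<integral>\<omega>. G \<omega> x \<partial>M))"
    by (simp add: eq)
qed

theorem corollary6p2:
  fixes M :: "'a measure" and p1 p2 :: real
    and F :: "real \<Rightarrow> real" and Fn :: "nat \<Rightarrow> 'a \<Rightarrow> real \<Rightarrow> real"
  assumes "prob_space M"
    and "0 < p1" and "p1 < p2" and "p2 < 1"
    and "is_cdf F"
    and "\<And>n. random_cdf M (Fn n)"
    and "\<And>n x. (\<integral>\<omega>. Fn n \<omega> x \<partial>M) = F x"
    and "\<And>n p. p \<in> {p1, p2} \<Longrightarrow>
           integrable (completion M) (\<lambda>\<omega>. real_of_ereal (quantile (Fn n \<omega>) p))"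
  shows "\<forall>n.
    integrable (completion M)
      (\<lambda>\<omega>. LBINT u=ereal p1..ereal p2. real_of_ereal (quantile (Fn n \<omega>) u)) \<and>
    integrable (completion M) (\<lambda>\<omega>. Rem p2 F (Fn n \<omega>)) \<and>
    integrable (completion M) (\<lambda>\<omega>. Rem p1 F (Fn n \<omega>)) \<and>
    (\<integral>\<omega>. (LBINT u=ereal p1..ereal p2. real_of_ereal (quantile (Fn n \<omega>) u)) \<partial>completion M)
      - (LBINT u=ereal p1..ereal p2. real_of_ereal (quantile F u))
    = (\<integral>\<omega>. Rem p2 F (Fn n \<omega>) \<partial>completion M)
      - (\<integral>\<omega>. Rem p1 F (Fn n \<omega>) \<partial>completion M)"
  unfolding rquantile_def[symmetric]
proof
  fix n
  let ?C = "completion M" and ?G = "Fn n"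
  let ?J = "\<lambda>G. LBINT x=rquantile F p1..rquantile F p2. G x"
  let ?I = "\<lambda>G. LBINT u=p1..p2. rquantile G u"
  note F = \<open>is_cdf F\<close> and G = assms(6)[of n] and p = assms(2-4)
  interpret M: prob_space M by fact
  interpret C: prob_space ?C
    by (rule prob_spaceI) (simp add: M.emeasure_space_1)
  have int: "integrable ?C (\<lambda>\<omega>. rquantile (?G \<omega>) p1)" "integrable ?C (\<lambda>\<omega>. rquantile (?G \<omega>) p2)"
    using assms(8) by (simp_all add: rquantile_def)
  have R1: "integrable ?C (\<lambda>\<omega>. Rem p1 F (?G \<omega>))" and R2: "integrable ?C (\<lambda>\<omega>. Rem p2 F (?G \<omega>))"
    using p int by (auto intro!: integrable_Rem[OF assms(1) F G])
  have q12: "rquantile F p1 \<le> rquantile F p2"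
    using p by (intro rquantile_mono[OF F]) auto
  have J: "integrable ?C (\<lambda>\<omega>. ?J (?G \<omega>))" "(\<integral>\<omega>. ?J (?G \<omega>) \<partial>?C) = ?J F"
    using expectation_interval_integral[OF assms(1) G q12] by (simp_all add: assms(7))
  \<comment> \<open>\<open>?R\<close> is \<open>Rem_diff\<close> solved for the quantile integral of
    the realisation. Its summands are already known to be integrable, so measurability and
    integrability of that integral are inherited from it.\<close>
  let ?R = "\<lambda>\<omega>. Rem p2 F (?G \<omega>) - Rem p1 F (?G \<omega>) + ?I F - (?J (?G \<omega>) - ?J F)"
  have eq: "AE \<omega> in M. ?R \<omega> = ?I (?G \<omega>)"
    using G Rem_diff[OF F _ p] by (auto simp: random_cdf_def elim!: eventually_mono)
  have R: "integrable ?C ?R"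
    using R1 R2 J by simp
  have I_meas: "(\<lambda>\<omega>. ?I (?G \<omega>)) \<in> borel_measurable ?C"
    using borel_measurable_integrable[OF R] eq by (rule borel_measurable_completion_AE)
  have I: "integrable ?C (\<lambda>\<omega>. ?I (?G \<omega>))"
    using integrable_cong_AE_imp[OF R I_meas] AE_completion[OF eq] by (simp add: eq_commute)
  have "(\<integral>\<omega>. ?I (?G \<omega>) \<partial>?C) = (\<integral>\<omega>. ?R \<omega> \<partial>?C)"
    using AE_completion[OF eq] I_meas borel_measurable_integrable[OF R]
    by (intro integral_cong_AE) (auto simp: eq_commute)
  \<comment> \<open>Unbiasedness enters here through \<open>J\<close>: the term
    \<open>?J (?G \<omega>) - ?J F\<close> has expectation zero.\<close>
  also have "\<dots> = (\<integral>\<omega>. Rem p2 F (?G \<omega>) \<partial>?C) - (\<integral>\<omega>. Rem p1 F (?G \<omega>) \<partial>?C) + ?I F"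
    using R1 R2 J by (simp add: M.prob_space)
  finally show "integrable ?C (\<lambda>\<omega>. ?I (?G \<omega>)) \<and> integrable ?C (\<lambda>\<omega>. Rem p2 F (?G \<omega>)) \<and>
      integrable ?C (\<lambda>\<omega>. Rem p1 F (?G \<omega>)) \<and>
      (\<integral>\<omega>. ?I (?G \<omega>) \<partial>?C) - ?I F
      = (\<integral>\<omega>. Rem p2 F (?G \<omega>) \<partial>?C) - (\<integral>\<omega>. Rem p1 F (?G \<omega>) \<partial>?C)"
    using I R1 R2 by simp
qed

end
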